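(* Let $a>0$ and $q_*>0$ be fixed. For any $u_\ell,u_r\in\Omega$ the following holds: (i) if $(u_\ell,u_r)\in\mathsf{CH}_\ell\times\Omega$, then $\mathcal{RS}_{\rm h}[u_\ell,u_r]\equiv\mathcal{RS}_{\rm v}[u_\ell,u_r]$; (ii) if $(u_\ell,u_r)\in\mathsf{CH}_\ell^{\complement}\times\Omega$, then $$\mathcal{RS}_{\rm h}[u_\ell,u_r](\xi)=\begin{cases}u_\ell&\text{if }\xi<0,\\ \mathcal{RS}_{\rm p}[\check u(q_\ell,u_r),u_r](\xi)&\text{if }\xi\ge0,\end{cases}$$ and for every c-Riemann solver $\mathcal{RS}_{\rm c}$ we have $$q\left(\mathcal{RS}_{\rm c}[u_\ell,u_r]\right)(0)\le q\left(\mathcal{RS}_{\rm h}[u_\ell,u_r]\right)(0)\in(0,q_* ),$$ where $q(\cdot)$ denotes the second component of a state in $\Omega$; (iii) $\mathcal{RS}_{\rm h}$ is coherent in $\mathsf D$, i.e. coherent at every $(u_\ell,u_r)\in\mathsf D$.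
   Context: Fix the sound speed $a>0$ and the flow threshold $q_*>0$. Let $\Omega\doteq\{(\rho,q)\in\mathbb R^2:\rho>0\}$ and $\mathsf D\doteq\Omega\times\Omega$. For $u=(\rho,q)\in\Omega$ write $v\doteq q/\rho$; subscripts and decorations carry over (e.g. $u_\ell=(\rho_\ell,q_\ell)$, $v_\ell=q_\ell/\rho_\ell$). The system considered is $\partial_t\rho+\partial_xq=0$, $\partial_tq+\partial_x(q^2/\rho+a^2\rho)=0$, with eigenvalues $\lambda_1(u)=v-a$, $\lambda_2(u)=v+a$. Lax curves. For $u_o\in\Omega$, $\rho>0$ and $i\in\{1,2\}$ let $\mathcal S_i^{u_o}(\rho)=\rho\left(\frac{q_o}{\rho_o}+(-1)^ia\left(\sqrt{\rho/\rho_o}-\sqrt{\rho_o/\rho}\right)\right)$ and $\mathcal R_i^{u_o}(\rho)=\rho\left(\frac{q_o}{\rho_o}+(-1)^ia\ln(\rho/\rho_o)\right)$. The forward 1-Lax curve $\mathsf{FL}_1^{u_o}$ is the graph $q=\mathcal R_1^{u_o}(\rho)$ for $\rho\le\rho_o$, $q=\mathcal S_1^{u_o}(\rho)$ for $\rho>\rho_o$. The backward 2-Lax curve $\mathsf{BL}_2^{u_o}$ is the graph $q=\mathcal R_2^{u_o}(\rho)$ for $\rho\le\rho_o$, $q=\mathcal S_2^{u_o}(\rho)$ for $\rho>\rho_o$. Special states. $\bar u(u_\ell)=(\bar\rho(u_\ell),\bar q(u_\ell))$ is the element of $\mathsf{FL}_1^{u_\ell}$ with maximum $q$-coordinate; $\tilde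 u(u_\ell,u_r)$ is the unique element of $\mathsf{FL}_1^{u_\ell}\cap\mathsf{BL}_2^{u_r}$; for $q_o\le\bar q(u_\ell)$, $\hat u(q_o,u_\ell)$ is the intersection of $\mathsf{FL}_1^{u_\ell}$ with the line $q=q_o$ having the largest $\rho$-coordinate; for $q_o\ge0$, $\check u(q_o,u_r)$ is the intersection of $\mathsf{BL}_2^{u_r}$ with the line $q=q_o$ having the largest $\rho$-coordinate. Lax Riemann solver. $\mathcal{RS}_{\rm p}[u_\ell,u_r](\xi)$, $\xi=x/t$, is the self-similar entropy weak solution of the Riemann problem with left state $u_\ell$ and right state $u_r$. It consists of a 1-wave from $u_\ell$ to $\tilde u=\tilde u(u_\ell,u_r)$ followed by a 2-wave from $\tilde u$ to $u_r$. The 1-wave is a shock of speed $v_\ell-a\sqrt{\tilde\rho/\rho_\ell}$ if $\tilde\rho>\rho_\ell$, and a rarefaction (states on $\mathsf{FL}_1^{u_\ell}$ with $\lambda_1=\xi$) if $\tilde\rho<\rho_\ell$; the 2-wave is a shock of speed $v_r+a\sqrt{\tilde\rho/\rho_r}$ if $\tilde\rho>\rho_r$, and a rarefaction (states on $\mathsf{BL}_2^{u_r}$ with $\lambda_2=\xi$) if $\tilde\rho<\rho_r$; a wave is absent when the corresponding states coincide. At jump points take the right-continuous representative. Maximal flow. $\overline Q(u)\doteq\bar q(u)=\frac{a\rho}{e}\exp(v/a)$ if $v\le a$, and $\overline Q(u)\doteq q$ if $v>a$. One has $\overline Q(u_\ell)\le\bar q(u_\ell)$. c-Riemann solvers. Given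 $Q:\mathsf D\to\mathbb R$ with $Q(u_\ell,u_r)\in[0,\overline Q(u_\ell)]$ for all $(u_\ell,u_r)\in\mathsf D$, the corresponding c-Riemann solver is $\mathcal{RS}_{\rm c}[u_\ell,u_r](\xi)=\mathcal{RS}_{\rm p}[u_\ell,\hat u(Q(u_\ell,u_r),u_\ell)](\xi)$ if $\xi<0$, and $\mathcal{RS}_{\rm c}[u_\ell,u_r](\xi)=\mathcal{RS}_{\rm p}[\check u(Q(u_\ell,u_r),u_r),u_r](\xi)$ if $\xi\ge0$. A c-Riemann solver is any map arising in this way from some such $Q$. Coherence. A c-Riemann solver $\mathcal{RS}_{\rm c}$ is coherent at $(u_\ell,u_r)\in\mathsf D$ if the traces $u_{\rm c}^\pm\doteq\mathcal{RS}_{\rm c}[u_\ell,u_r](0^\pm)$ satisfy $\mathcal{RS}_{\rm c}[u_{\rm c}^-,u_{\rm c}^+](\xi)=u_{\rm c}^-$ for $\xi<0$ and $=u_{\rm c}^+$ for $\xi\ge0$. The solver $\mathcal{RS}_{\rm v}$ is the c-Riemann solver corresponding to $Q_{\rm v}(u_\ell)=q_*$ if $\overline Q(u_\ell)\ge q_*$ and $Q_{\rm v}(u_\ell)=0$ if $\overline Q(u_\ell)<q_*$. The sets $\mathsf{CH}_\ell$, $\mathsf{CH}_\ell^\complement$. Let $u_*^0\doteq(e\,q_*/a,0)$. For $0<\rho<e\,q_*/a$ the curve $q=\mathcal S_1^{u_*^0}(\rho)$ meets the line $q=q_*$ in exactly two points, one supersonic ($|v|>a$), denoted $u_*^{\sup}$,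 and one subsonic ($|v|<a$); let $v_*^{\sup}$ be the velocity of $u_*^{\sup}$ (it does not depend on $q_*$; $v_*^{\sup}\approx1.63\,a$). Set $\mathsf{CH}_\ell^{\complement}\doteq\{u\in\Omega:\ v>v_*^{\sup},\ \mathcal S_1^{u_*^0}(\rho)\le q<q_*\}$ and $\mathsf{CH}_\ell\doteq\Omega\setminus\mathsf{CH}_\ell^\complement$. It is known that $\mathsf{CH}_\ell^\complement\times\Omega$ is exactly the set of pairs at which $\mathcal{RS}_{\rm v}$ is not coherent. Moreover $\overline Q(u_\ell)<q_*$ whenever $u_\ell\in\mathsf{CH}_\ell^\complement$. The solver $\mathcal{RS}_{\rm h}$ is the c-Riemann solver corresponding to $Q_{\rm h}(u_\ell)=q_*$ if $\overline Q(u_\ell)\ge q_*$; $Q_{\rm h}(u_\ell)=0$ if $\overline Q(u_\ell)<q_*$ and $u_\ell\in\mathsf{CH}_\ell$; $Q_{\rm h}(u_\ell)=q_\ell$ if $u_\ell\in\mathsf{CH}_\ell^\complement$. *)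

theory Defs
  imports "HOL-Analysis.Analysis"
begin

text \<open>
  States are pairs \<open>u = (\<rho>, q)\<close>.  The sound speed \<open>a\<close> and the flow threshold \<open>qs\<close>
  (written \<open>q_*\<close> in prose) are explicit parameters of the definitions; they are assumed positive
  where results are stated.
\<close>

type_synonym state = "real \<times> real"

definition Omega :: "state set" where
  "Omega = {u. fst u > 0}"

definition D :: "(state \<times> state) set" where
  "D = Omega \<times> Omega"

definition vel :: "state \<Rightarrow> real" where
  "vel u = snd u / fst u"

definition lambda1 :: "real \<Rightarrow> state \<Rightarrow> real" where
  "lambda1 a u = vel u - a"

definition lambda2 :: "real \<Rightarrow> state \<Rightarrow> real" where
  "lambda2 a u = vel u + a"

definition lax_S :: "real \<Rightarrow> nat \<Rightarrow> state \<Rightarrow> real \<Rightarrow> real" where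
  "lax_S a i uo \<rho> =
     \<rho> * (snd uo / fst uo + (- 1) ^ i * a * (sqrt (\<rho> / fst uo) - sqrt (fst uo / \<rho>)))"

definition lax_R :: "real \<Rightarrow> nat \<Rightarrow> state \<Rightarrow> real \<Rightarrow> real" where
  "lax_R a i uo \<rho> = \<rho> * (snd uo / fst uo + (- 1) ^ i * a * ln (\<rho> / fst uo))"

definition FL1 :: "real \<Rightarrow> state \<Rightarrow> state set" where
  "FL1 a uo = {(\<rho>, q). \<rho> > 0 \<and> q = (if \<rho> \<le> fst uo then lax_R a 1 uo \<rho> else lax_S a 1 uo \<rho>)}"

definition BL2 :: "real \<Rightarrow> state \<Rightarrow> state set" where
  "BL2 a uo = {(\<rho>, q). \<rho> > 0 \<and> q = (if \<rho> \<le> fst uo then lax_R a 2 uo \<rho> else lax_S a 2 uo \<rho>)}"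

definition u_bar :: "real \<Rightarrow> state \<Rightarrow> state" where
  "u_bar a ul = arg_max_on snd (FL1 a ul)"

definition u_tilde :: "real \<Rightarrow> state \<Rightarrow> state \<Rightarrow> state" where
  "u_tilde a ul ur = (THE u. u \<in> FL1 a ul \<inter> BL2 a ur)"

definition u_hat :: "real \<Rightarrow> real \<Rightarrow> state \<Rightarrow> state" where
  "u_hat a qo ul = arg_max_on fst {u \<in> FL1 a ul. snd u = qo}"

definition u_check :: "real \<Rightarrow> real \<Rightarrow> state \<Rightarrow> state" where
  "u_check a qo ur = arg_max_on fst {u \<in> BL2 a ur. snd u = qo}"

text \<open>
  In the Lax solver, the 1-wave occupies \<open>s1 \<le> \<xi> < s1'\<close> and the 2-wave \<open>s2 \<le> \<xi> < s2'\<close>, where the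
  two bounds agree for a shock (or when the wave is absent).  The strict upper and non-strict lower
  bounds select the right-continuous representative.
\<close>

definition RS_p :: "real \<Rightarrow> state \<Rightarrow> state \<Rightarrow> real \<Rightarrow> state" where
  "RS_p a ul ur \<xi> =
    (let ut = u_tilde a ul ur;
         (s1, s1') =
           (if fst ut > fst ul
            then (vel ul - a * sqrt (fst ut / fst ul), vel ul - a * sqrt (fst ut / fst ul))
            else (lambda1 a ul, lambda1 a ut));
         (s2, s2') =
           (if fst ut > fst ur
            then (vel ur + a * sqrt (fst ut / fst ur), vel ur + a * sqrt (fst ut / fst ur))
            else (lambda2 a ut, lambda2 a ur))
     in if \<xi> < s1 then ul
        else if \<xi> < s1' then (THE u. u \<in> FL1 a ul \<and> lambda1 a u = \<xi>)
        else if \<xi> < s2 then ut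
        else if \<xi> < s2' then (THE u. u \<in> BL2 a ur \<and> lambda2 a u = \<xi>)
        else ur)"

text \<open>For \<open>v \<le> a\<close> the maximal flow has the closed form \<open>a * \<rho> / exp 1 * exp (v / a)\<close>.\<close>

definition Q_max :: "real \<Rightarrow> state \<Rightarrow> real" where
  "Q_max a u = (if vel u \<le> a then snd (u_bar a u) else snd u)"

definition RS_c :: "real \<Rightarrow> (state \<Rightarrow> state \<Rightarrow> real) \<Rightarrow> state \<Rightarrow> state \<Rightarrow> real \<Rightarrow> state" where
  "RS_c a Q ul ur \<xi> =
    (if \<xi> < 0 then RS_p a ul (u_hat a (Q ul ur) ul) \<xi>
     else RS_p a (u_check a (Q ul ur) ur) ur \<xi>)"

definition c_Riemann_solver :: "real \<Rightarrow> (state \<Rightarrow> state \<Rightarrow> real \<Rightarrow> state) \<Rightarrow> bool" where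
  "c_Riemann_solver a RS \<longleftrightarrow>
    (\<exists>Q. \<forall>(ul, ur) \<in> D. Q ul ur \<in> {0..Q_max a ul} \<and> RS ul ur = RS_c a Q ul ur)"

text \<open>
  The traces at \<open>0\<close> are the one-sided limits.  Their existence, and their membership in the domain of
  the solver, is made part of coherence.
\<close>

definition coherent_at :: "(state \<Rightarrow> state \<Rightarrow> real \<Rightarrow> state) \<Rightarrow> state \<Rightarrow> state \<Rightarrow> bool" where
  "coherent_at RS ul ur \<longleftrightarrow>
    (\<exists>um up. (RS ul ur \<longlongrightarrow> um) (at_left 0) \<and> (RS ul ur \<longlongrightarrow> up) (at_right 0) \<and> (um, up) \<in> D \<and>
       (\<forall>\<xi>. RS um up \<xi> = (if \<xi> < 0 then um else up)))"

definition Q_v :: "real \<Rightarrow> real \<Rightarrow> state \<Rightarrow> real" where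
  "Q_v a qs ul = (if Q_max a ul \<ge> qs then qs else 0)"

definition RS_v :: "real \<Rightarrow> real \<Rightarrow> state \<Rightarrow> state \<Rightarrow> real \<Rightarrow> state" where
  "RS_v a qs = RS_c a (\<lambda>ul ur. Q_v a qs ul)"

definition u_star0 :: "real \<Rightarrow> real \<Rightarrow> state" where
  "u_star0 a qs = (exp 1 * qs / a, 0)"

definition u_star_sup :: "real \<Rightarrow> real \<Rightarrow> state" where
  "u_star_sup a qs =
    (THE u. 0 < fst u \<and> fst u < exp 1 * qs / a \<and>
       snd u = lax_S a 1 (u_star0 a qs) (fst u) \<and> snd u = qs \<and> \<bar>vel u\<bar> > a)"

definition CHl_compl :: "real \<Rightarrow> real \<Rightarrow> state set" where
  "CHl_compl a qs =
    {u \<in> Omega. vel u > vel (u_star_sup a qs) \<and>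
       lax_S a 1 (u_star0 a qs) (fst u) \<le> snd u \<and> snd u < qs}"

definition CHl :: "real \<Rightarrow> real \<Rightarrow> state set" where
  "CHl a qs = Omega - CHl_compl a qs"

text \<open>
  The cases are exhaustive and disjoint on \<open>Omega\<close>, since \<open>Q_max a ul < qs\<close> for \<open>ul \<in> CHl_compl a qs\<close>.
\<close>

definition Q_h :: "real \<Rightarrow> real \<Rightarrow> state \<Rightarrow> real" where
  "Q_h a qs ul =
    (if Q_max a ul \<ge> qs then qs
     else if ul \<in> CHl a qs then 0
     else snd ul)"

definition RS_h :: "real \<Rightarrow> real \<Rightarrow> state \<Rightarrow> state \<Rightarrow> real \<Rightarrow> state" where
  "RS_h a qs = RS_c a (\<lambda>ul ur. Q_h a qs ul)"

end

theory Submission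
  imports Defs
begin

text \<open>
  In the variables \<open>(\<rho>, v)\<close> the forward 1-curve from \<open>u\<close> is \<open>v = v\<^sub>u - a \<phi>(\<rho> / \<rho>\<^sub>u)\<close> and the
  backward 2-curve is \<open>v = v\<^sub>u + a \<phi>(\<rho> / \<rho>\<^sub>u)\<close>, with one increasing profile \<open>\<phi>\<close>. The 2-waves leaving a
  state with \<open>q \<ge> 0\<close> have positive speed, so the trace of a c-Riemann solver at \<open>0+\<close> carries exactly
  the flow \<open>Q\<close>; on the left either the 1-wave has nonpositive speed and the trace is the subsonic state
  \<open>\<hat>u\<close>, or \<open>u\<^sub>\<ell>\<close> is supersonic with \<open>q\<^sub>\<ell> = Q\<close> and the 1-wave is a shock of speed \<open>0\<close>. Coherence thus
  amounts to \<open>Q\<^sub>h\<close> taking the same value at \<open>u\<^sub>\<ell>\<close> and at the left trace. The only nontrivial case is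
  \<open>Q\<^sub>h = 0\<close> with \<open>u\<^sub>\<ell>\<close> supersonic, where the trace is at rest with density \<open>R\<close> and one needs
  \<open>a R / e < q\<^sub>*\<close>. With \<open>x = sqrt (\<rho>\<^sub>\<ell> / R)\<close> one has \<open>q\<^sub>\<ell> = a R (x - x\<^sup>3)\<close> and \<open>v\<^sub>\<ell> = a (1 / x - x)\<close>, and the
  bound reduces to the sign of \<open>x - x\<^sup>3 - 1 / e\<close> on \<open>x\<^sup>2 + x < 1\<close>.
\<close>

section \<open>The common wave profile of the Lax curves\<close>

definition lax_profile :: "real \<Rightarrow> real" where
  "lax_profile t = (if t \<le> 1 then ln t else sqrt t - 1 / sqrt t)"

text \<open>With \<open>s = sqrt t\<close>, the function \<open>s - 1 / s - 2 * ln s\<close>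
  vanishes at \<open>1\<close> and has derivative \<open>(1 - 1 / s)\<^sup>2\<close>. The bound
  later compares the shock branch with the continued rarefaction branch.\<close>

lemma ln_le_sqrt_diff:
  fixes t :: real
  assumes "t \<ge> 1"
  shows "ln t \<le> sqrt t - 1 / sqrt t"
proof -
  let ?g = "\<lambda>s::real. s - 1 / s - 2 * ln s"
  have s1: "sqrt t \<ge> 1" using assms by simp
  have "?g 1 \<le> ?g (sqrt t)"
  proof (rule DERIV_nonneg_imp_nondecreasing[OF s1])
    fix s :: real assume "1 \<le> s"
    then have "(?g has_real_derivative (1 - 1 / s)\<^sup>2) (at s)"
      by (auto intro!: derivative_eq_intros simp: power2_eq_square field_simps)
    then show "\<exists>y. (?g has_real_derivative y) (at s) \<and> 0 \<le> y" by fastforce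
  qed
  moreover have "2 * ln (sqrt t) = ln t" using assms by (simp add: ln_sqrt)
  ultimately show ?thesis by simp
qed

lemma sqrt_diff_strict_mono:
  fixes x y :: real
  assumes "0 < x" "x < y"
  shows "sqrt x - 1 / sqrt x < sqrt y - 1 / sqrt y"
proof -
  have "sqrt x < sqrt y" "sqrt x > 0" using assms by auto
  moreover from this have "1 / sqrt y < 1 / sqrt x" by (simp add: frac_less2)
  ultimately show ?thesis by linarith
qed

lemma lax_profile_strict_mono:
  assumes "0 < x" "x < y"
  shows "lax_profile x < lax_profile y"
proof -
  have "ln x \<le> 0" if "x \<le> 1" using assms that by simp
  moreover have "sqrt y - 1 / sqrt y > 0" if "y > 1"
    using sqrt_diff_strict_mono[of 1 y] that by simp
  moreover have "sqrt x - 1 / sqrt x < sqrt y - 1 / sqrt y"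
    using sqrt_diff_strict_mono assms by blast
  moreover have "ln x < ln y" using assms by simp
  ultimately show ?thesis
    using assms(2) unfolding lax_profile_def by (smt (verit))
qed

lemma continuous_on_lax_profile: "continuous_on {0<..} lax_profile"
proof -
  have "continuous_on ({0<..1} \<union> {1..}) lax_profile"
    unfolding lax_profile_def
  proof (rule continuous_on_cases_local)
    have *: "{0<..1} \<union> {1..} = {0::real<..}" by auto
    show "closedin (top_of_set ({0<..1} \<union> {1..})) {0::real<..1}"
      unfolding * closedin_closed by (rule exI[of _ "{..1}"]) auto
    show "closedin (top_of_set ({0<..1} \<union> {1..})) {1::real..}"
      unfolding * closedin_closed by (rule exI[of _ "{1..}"]) auto
  qed (auto intro!: continuous_intros)
  moreover have "{0<..1} \<union> {1..} = {0::real<..}" by auto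
  ultimately show ?thesis by simp
qed

section \<open>Lax curves in density and velocity\<close>

definition FL1_flux :: "real \<Rightarrow> state \<Rightarrow> real \<Rightarrow> real" where
  "FL1_flux a u \<rho> = \<rho> * (vel u - a * lax_profile (\<rho> / fst u))"

lemma snd_eq_fst_vel: "u \<in> Omega \<Longrightarrow> snd u = fst u * vel u"
  by (simp add: Omega_def vel_def)

lemma sqrt_flip: "sqrt (x / y) = 1 / sqrt (y / x)"
  by (simp add: real_sqrt_divide)

lemma FL1_iff_flux:
  assumes "u \<in> Omega"
  shows "w \<in> FL1 a u \<longleftrightarrow> fst w > 0 \<and> snd w = FL1_flux a u (fst w)"
proof (cases w)
  case (Pair r q)
  have "sqrt (fst u / r) = 1 / sqrt (r / fst u)" by (rule sqrt_flip)
  then show ?thesis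
    using assms Pair
    by (auto simp: FL1_def FL1_flux_def lax_R_def lax_S_def lax_profile_def Omega_def vel_def)
qed

lemma FL1_iff_vel:
  assumes "u \<in> Omega"
  shows "w \<in> FL1 a u \<longleftrightarrow> w \<in> Omega \<and> vel w = vel u - a * lax_profile (fst w / fst u)"
  using snd_eq_fst_vel[of w] unfolding FL1_iff_flux[OF assms] FL1_flux_def by (auto simp: Omega_def)

lemma BL2_iff_vel:
  assumes "u \<in> Omega"
  shows "w \<in> BL2 a u \<longleftrightarrow> w \<in> Omega \<and> vel w = vel u + a * lax_profile (fst w / fst u)"
proof (cases w)
  case (Pair r q)
  have *: "sqrt (fst u / r) = 1 / sqrt (r / fst u)" by (rule sqrt_flip)
  have "w \<in> BL2 a u \<longleftrightarrow> r > 0 \<and> q = r * (vel u + a * lax_profile (r / fst u))"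
    using assms Pair *
    by (auto simp: BL2_def lax_R_def lax_S_def lax_profile_def Omega_def vel_def)
  then show ?thesis using Pair by (auto simp: Omega_def vel_def field_simps)
qed

text \<open>Reversing the sign of \<open>q\<close> exchanges the two families. This transfers
  existence of crossings from forward 1-curves to backward 2-curves.\<close>

lemma BL2_iff_reflected:
  assumes "u \<in> Omega"
  shows "w \<in> BL2 a u \<longleftrightarrow> (fst w, - snd w) \<in> FL1 a (fst u, - snd u)"
proof -
  have "(fst u, - snd u) \<in> Omega" using assms by (simp add: Omega_def)
  then show ?thesis
    unfolding BL2_iff_vel[OF assms] FL1_iff_vel[OF \<open>(fst u, - snd u) \<in> Omega\<close>]
    by (auto simp: Omega_def vel_def)
qed

lemma self_in_FL1: "u \<in> Omega \<Longrightarrow> u \<in> FL1 a u"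
  and self_in_BL2: "u \<in> Omega \<Longrightarrow> u \<in> BL2 a u"
  by (simp_all add: FL1_iff_vel BL2_iff_vel Omega_def lax_profile_def)

lemma FL1_vel_antimono:
  assumes "a > 0" "u \<in> Omega" "w \<in> FL1 a u" "w' \<in> FL1 a u" "fst w < fst w'"
  shows "vel w' < vel w"
  using assms lax_profile_strict_mono[of "fst w / fst u" "fst w' / fst u"]
  by (auto simp: FL1_iff_vel Omega_def divide_strict_right_mono)

lemma BL2_vel_mono:
  assumes "a > 0" "u \<in> Omega" "w \<in> BL2 a u" "w' \<in> BL2 a u" "fst w < fst w'"
  shows "vel w < vel w'"
  using assms lax_profile_strict_mono[of "fst w / fst u" "fst w' / fst u"]
  by (auto simp: BL2_iff_vel Omega_def divide_strict_right_mono)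

lemma state_eqI: "fst u = fst w \<Longrightarrow> vel u = vel w \<Longrightarrow> u \<in> Omega \<Longrightarrow> u = w"
  by (cases u; cases w) (auto simp: vel_def Omega_def)

section \<open>The Lax solver when only one wave is present\<close>

text \<open>Velocity strictly decreases with density along the first curve and strictly increases
  along the second, so two common points must share their density. A common point \<open>w\<close>
  is supplied at each use.\<close>

lemma u_tilde_eqI:
  assumes "a > 0" "ul \<in> Omega" "ur \<in> Omega" "w \<in> FL1 a ul" "w \<in> BL2 a ur"
  shows "u_tilde a ul ur = w"
  unfolding u_tilde_def
proof (rule the_equality)
  show "w \<in> FL1 a ul \<inter> BL2 a ur" using assms by simp
next
  fix u assume u: "u \<in> FL1 a ul \<inter> BL2 a ur"
  then have "\<not> fst u < fst w" "\<not> fst w < fst u"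
    using assms FL1_vel_antimono[of a ul] BL2_vel_mono[of a ur] by (meson IntD1 IntD2 less_asym)+
  then have "fst u = fst w" by simp
  with u assms show "u = w" by (intro state_eqI) (auto simp: FL1_iff_vel)
qed

text \<open>The middle state is \<open>w\<close> itself, so both 2-wave bounds are
  \<open>lambda2 a w\<close> and the last branches all return \<open>w\<close>.\<close>

lemma RS_p_one_wave:
  assumes "a > 0" "ul \<in> Omega" "w \<in> FL1 a ul"
  shows "RS_p a ul w \<xi> =
    (if fst w > fst ul then (if \<xi> < vel ul - a * sqrt (fst w / fst ul) then ul else w)
     else if \<xi> < lambda1 a ul then ul
     else if \<xi> < lambda1 a w then (THE u. u \<in> FL1 a ul \<and> lambda1 a u = \<xi>)
     else w)"
proof -
  have "w \<in> Omega" using assms by (simp add: FL1_iff_vel)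
  then have "u_tilde a ul w = w" using assms by (intro u_tilde_eqI self_in_BL2)
  then show ?thesis by (simp add: RS_p_def)
qed

lemma RS_p_same:
  assumes "a > 0" "u \<in> Omega"
  shows "RS_p a u u \<xi> = u"
  using assms by (simp add: RS_p_one_wave self_in_FL1)

text \<open>Here the 1-wave is absent and \<open>s\<close> is the slowest speed of the 2-wave. With
  \<open>t\<close> the density ratio, a shock moves at \<open>vel w + a / sqrt t\<close> and a fan
  starts at \<open>vel w + a\<close>; both are positive since \<open>vel w \<ge> 0\<close>.\<close>

lemma RS_p_before_two_wave:
  assumes "a > 0" "ur \<in> Omega" "w \<in> BL2 a ur" "snd w \<ge> 0"
  obtains s where "s > 0" "\<And>\<xi>. \<xi> < s \<Longrightarrow> RS_p a w ur \<xi> = w"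
proof
  have w: "w \<in> Omega" using assms by (simp add: BL2_iff_vel)
  then have ut: "u_tilde a w ur = w" using assms by (intro u_tilde_eqI self_in_FL1)
  let ?t = "fst w / fst ur"
  let ?s = "if fst w > fst ur then vel ur + a * sqrt ?t else lambda2 a w"
  have v: "vel w \<ge> 0" using assms w by (simp add: vel_def Omega_def)
  have "vel ur + a * sqrt ?t > 0" if "fst w > fst ur"
  proof -
    have "?t > 1" using that assms by (simp add: Omega_def)
    then have "0 \<le> vel ur + a * (sqrt ?t - 1 / sqrt ?t)" "0 < a / sqrt ?t"
      using v assms by (auto simp: BL2_iff_vel lax_profile_def)
    then show ?thesis by (simp add: algebra_simps)
  qed
  then show "?s > 0" using v assms by (auto simp: lambda2_def)
  show "RS_p a w ur \<xi> = w" if "\<xi> < ?s" for \<xi>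
    using ut that by (cases "fst w > fst ur") (simp_all add: RS_p_def)
qed

section \<open>Existence and characterization of the states of prescribed flow\<close>

text \<open>\<open>arg_max_on\<close> chooses some maximizer; since all points of \<open>S\<close>
  share their second component, the maximizer of the first one is unique.\<close>

lemma arg_max_on_fst_eqI:
  fixes S :: "state set"
  assumes "w \<in> S" "\<And>x. x \<in> S \<Longrightarrow> snd x = snd w" "\<And>x. x \<in> S \<Longrightarrow> fst x \<le> fst w"
  shows "arg_max_on fst S = w"
  unfolding arg_max_on_def arg_max_def is_arg_max_def
proof (rule some_equality)
  show "w \<in> S \<and> (\<nexists>y. y \<in> S \<and> fst w < fst y)" using assms(1,3) by (meson not_less)
next
  fix x assume x: "x \<in> S \<and> (\<nexists>y. y \<in> S \<and> fst x < fst y)"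
  then have "fst x \<le> fst w" "\<not> fst x < fst w" "snd x = snd w" using assms by blast+
  then show "x = w" by (simp add: prod_eq_iff)
qed

lemma u_hat_eqI:
  assumes "u \<in> Omega" "w \<in> FL1 a u" "snd w = q" "\<And>\<rho>. \<rho> > fst w \<Longrightarrow> FL1_flux a u \<rho> < q"
  shows "u_hat a q u = w"
  unfolding u_hat_def
proof (rule arg_max_on_fst_eqI)
  fix x assume "x \<in> {x \<in> FL1 a u. snd x = q}"
  then show "fst x \<le> fst w" using assms(1) assms(4)[of "fst x"] by (force simp: FL1_iff_flux)
qed (use assms in auto)

text \<open>The point \<open>r\<close> is the maximum of the compact set where
  \<open>f \<ge> q\<close> on \<open>{c..K}\<close>. If \<open>f r > q\<close>, the intermediate
  value theorem on \<open>{r..K}\<close> would give a crossing beyond \<open>r\<close>.\<close>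

lemma last_crossing:
  fixes f :: "real \<Rightarrow> real"
  assumes "continuous_on {c..} f" "f c \<ge> q" "\<And>x. x \<ge> K \<Longrightarrow> f x < q"
  obtains r where "r \<ge> c" "f r = q" "\<And>x. x > r \<Longrightarrow> f x < q"
proof -
  define S where "S = {x \<in> {c..K}. f x \<ge> q}"
  have cont: "continuous_on {c..K} f" using assms(1) by (rule continuous_on_subset) auto
  have S: "S = {c..K} \<inter> f -` {q..}" by (auto simp: S_def)
  then have "closed S" using continuous_closed_preimage[OF cont] by simp
  moreover have "bounded S" unfolding S by (rule bounded_subset[of "{c..K}"]) auto
  ultimately have "compact S" by (simp add: compact_eq_bounded_closed)
  moreover have "c \<in> S" using assms(2) assms(3)[of c] by (force simp: S_def)
  ultimately obtain r where r: "r \<in> S" "\<And>x. x \<in> S \<Longrightarrow> x \<le> r"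
    using compact_attains_sup[of S] by blast
  have above: "f x < q" if "x > r" for x
    using r(1) r(2)[of x] that assms(3)[of x] by (force simp: S_def)
  have "f r = q"
  proof (rule ccontr)
    assume "f r \<noteq> q"
    with r(1) have "f r > q" by (simp add: S_def)
    have rK: "r \<le> K" "c \<le> r" using r(1) by (auto simp: S_def)
    have "f K \<le> q" using assms(3)[of K] by simp
    obtain x where "r \<le> x" "x \<le> K" "f x = q"
      using IVT2'[OF \<open>f K \<le> q\<close> less_imp_le[OF \<open>f r > q\<close>] rK(1)] continuous_on_subset[OF cont] rK
      by (metis atLeastatMost_subset_iff order_refl)
    with above[of x] \<open>f r \<noteq> q\<close> show False by (cases "x = r") auto
  qed
  with above r(1) show thesis by (intro that[of r]) (auto simp: S_def)
qed

lemma FL1_flux_eventually_less: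
  assumes "a > 0" "u \<in> Omega"
  obtains K where "\<And>x. x \<ge> K \<Longrightarrow> FL1_flux a u x < q"
proof
  have R: "fst u > 0" using assms by (simp add: Omega_def)
  \<comment> \<open>Chosen so that \<open>a * (N - 1) = \<bar>vel u\<bar> + 1\<close>: once the
    profile is at least \<open>N - 1\<close>, the velocity is at most \<open>-1\<close>, and a
    density above \<open>\<bar>q\<bar>\<close> then pushes the flow below \<open>q\<close>.\<close>
  define N where "N = 1 + (\<bar>vel u\<bar> + 1) / a"
  fix x assume x: "x \<ge> fst u * (1 + N\<^sup>2) + \<bar>q\<bar> + 1"
  have "fst u * (1 + N\<^sup>2) < x" using x by linarith
  then have t: "x / fst u > 1 + N\<^sup>2" using R by (simp add: field_simps)
  have "N \<ge> 1" using assms by (simp add: N_def)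
  have "sqrt (x / fst u) \<ge> N" using t \<open>N \<ge> 1\<close> by (intro real_le_rsqrt) simp
  moreover have t1: "x / fst u > 1" using t zero_le_power2[of N] by linarith
  then have "1 / sqrt (x / fst u) \<le> 1" by (simp add: real_le_rsqrt)
  ultimately have "lax_profile (x / fst u) \<ge> N - 1"
    using t1 unfolding lax_profile_def by (smt (verit))
  then have "a * lax_profile (x / fst u) \<ge> \<bar>vel u\<bar> + 1"
    using assms mult_left_mono[of "N - 1" "lax_profile (x / fst u)" a] by (simp add: N_def)
  then have le: "vel u - a * lax_profile (x / fst u) \<le> - 1" by linarith
  have "0 \<le> fst u * (1 + N\<^sup>2)" using R by simp
  then have "x \<ge> \<bar>q\<bar> + 1" using x by linarith
  then show "FL1_flux a u x < q"
    unfolding FL1_flux_def using mult_left_mono[OF le, of x] by linarith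
qed

lemma continuous_on_FL1_flux:
  assumes "u \<in> Omega"
  shows "continuous_on {0<..} (FL1_flux a u)"
  unfolding FL1_flux_def
  by (intro continuous_intros continuous_on_compose2[OF continuous_on_lax_profile])
     (use assms in \<open>auto simp: Omega_def\<close>)

lemma u_hat_exists:
  assumes "a > 0" "u \<in> Omega" "c > 0" "FL1_flux a u c \<ge> q"
  obtains w where "u_hat a q u = w" "w \<in> FL1 a u" "snd w = q"
    "\<And>\<rho>. \<rho> > fst w \<Longrightarrow> FL1_flux a u \<rho> < q"
proof -
  obtain K where K: "\<And>x. x \<ge> K \<Longrightarrow> FL1_flux a u x < q"
    using FL1_flux_eventually_less[OF assms(1,2)] by blast
  have "continuous_on {c..} (FL1_flux a u)"
    by (rule continuous_on_subset[OF continuous_on_FL1_flux[OF assms(2)]]) (use assms in auto)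
  then obtain r where "r \<ge> c" "FL1_flux a u r = q" "\<And>x. x > r \<Longrightarrow> FL1_flux a u x < q"
    using last_crossing[of c "FL1_flux a u" q K] assms(4) K by blast
  with assms show thesis
    by (intro that[of "(r, q)"] u_hat_eqI) (auto simp: FL1_iff_flux)
qed

text \<open>Any crossing is the only one: with growing density the velocity strictly increases along
  the curve, while on a line of constant \<open>q \<ge> 0\<close> it cannot increase.\<close>

lemma u_check_eqI:
  assumes "a > 0" "u \<in> Omega" "w \<in> BL2 a u" "snd w = q" "q \<ge> 0"
  shows "u_check a q u = w"
  unfolding u_check_def
proof (rule arg_max_on_fst_eqI)
  fix x assume x: "x \<in> {x \<in> BL2 a u. snd x = q}"
  show "fst x \<le> fst w"
  proof (rule ccontr)
    assume "\<not> fst x \<le> fst w"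
    then have less: "fst w < fst x" by simp
    then have "vel w < vel x" using assms x BL2_vel_mono[of a u w x] by simp
    moreover have "fst w > 0" using assms(2,3) by (simp add: BL2_iff_vel Omega_def)
    then have "vel x \<le> vel w" using x less assms(4,5) by (simp add: vel_def frac_le)
    ultimately show False by simp
  qed
qed (use assms in auto)

lemma u_check_exists:
  assumes "a > 0" "u \<in> Omega" "q \<ge> 0"
  obtains w where "u_check a q u = w" "w \<in> BL2 a u" "snd w = q"
proof -
  let ?u = "(fst u, - snd u)"
  have u: "?u \<in> Omega" using assms by (simp add: Omega_def)
  have R: "fst u > 0" using assms by (simp add: Omega_def)
  \<comment> \<open>Far enough down the rarefaction branch that the velocity is
    \<open>vel ?u + \<bar>vel ?u\<bar> \<ge> 0\<close>, hence the reflected flow is at least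
    \<open>0 \<ge> - q\<close>.\<close>
  let ?c = "fst u * exp (- \<bar>vel ?u\<bar> / a)"
  have c: "?c > 0" using R by simp
  have "lax_profile (?c / fst u) = - \<bar>vel ?u\<bar> / a" using R assms by (simp add: lax_profile_def)
  then have "FL1_flux a ?u ?c = ?c * (vel ?u + \<bar>vel ?u\<bar>)"
    using assms by (simp add: FL1_flux_def)
  then have "FL1_flux a ?u ?c \<ge> - q" using c assms by (smt (verit) mult_nonneg_nonneg)
  from u_hat_exists[OF assms(1) u c this]
  obtain w where w: "w \<in> FL1 a ?u" "snd w = - q" by metis
  let ?w = "(fst w, - snd w)"
  have "?w \<in> BL2 a u" using w(1) assms by (simp add: BL2_iff_reflected)
  then show thesis using w assms that[of ?w] u_check_eqI[of a u ?w q] by simp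
qed

section \<open>The right trace of a c-Riemann solver\<close>

lemma RS_c_at_zero_plus:
  assumes "a > 0" "ur \<in> Omega" "Q ul ur \<ge> 0"
  obtains w s where "w \<in> Omega" "snd w = Q ul ur" "s > 0"
    "\<And>\<xi>. 0 \<le> \<xi> \<Longrightarrow> \<xi> < s \<Longrightarrow> RS_c a Q ul ur \<xi> = w"
proof -
  obtain w where w: "u_check a (Q ul ur) ur = w" "w \<in> BL2 a ur" "snd w = Q ul ur"
    using u_check_exists[OF assms] by blast
  obtain s where "s > 0" "\<And>\<xi>. \<xi> < s \<Longrightarrow> RS_p a w ur \<xi> = w"
    using RS_p_before_two_wave[OF assms(1,2) w(2)] w assms by metis
  with w assms show thesis by (intro that[of w s]) (auto simp: RS_c_def BL2_iff_vel)
qed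

lemma snd_RS_c_zero:
  assumes "a > 0" "ur \<in> Omega" "Q ul ur \<ge> 0"
  shows "snd (RS_c a Q ul ur 0) = Q ul ur"
  using RS_c_at_zero_plus[of a ur Q ul] assms by (metis order_refl)

section \<open>Flow along the forward curve and the maximal flow\<close>

text \<open>This is the Rankine-Hugoniot relation for the density: the jump in flow is the shock
  speed times the jump in density. The sign of the shock speed thus decides how the flow compares
  with \<open>snd u\<close>.\<close>

lemma FL1_flux_shock:
  assumes "u \<in> Omega" "\<rho> > fst u"
  shows "FL1_flux a u \<rho> = snd u + (vel u - a * sqrt (\<rho> / fst u)) * (\<rho> - fst u)"
proof -
  have R: "fst u > 0" using assms by (simp add: Omega_def)
  define s where "s = sqrt (\<rho> / fst u)"
  have s: "s > 1" "\<rho> = fst u * s\<^sup>2" using assms R by (auto simp: s_def)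
  have "\<rho> / fst u > 1" using assms R by simp
  then have "FL1_flux a u \<rho> = \<rho> * (vel u - a * (s - 1 / s))"
    by (simp add: FL1_flux_def lax_profile_def s_def)
  also have "\<dots> = fst u * vel u + (vel u - a * s) * (\<rho> - fst u)"
    using s(1) unfolding s(2) by (simp add: field_simps power2_eq_square)
  finally show ?thesis using snd_eq_fst_vel[OF assms(1)] by (simp add: s_def)
qed

text \<open>From a state with \<open>vel u \<le> a\<close> every 1-shock has negative speed, so the
  flow drops below \<open>snd u\<close> at all larger densities.\<close>

lemma u_hat_subsonic_self:
  assumes "a > 0" "u \<in> Omega" "vel u \<le> a"
  shows "u_hat a (snd u) u = u"
proof (rule u_hat_eqI)
  fix \<rho> assume r: "\<rho> > fst u"
  have "sqrt (\<rho> / fst u) > 1" using r assms by (simp add: Omega_def)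
  then have "vel u - a * sqrt (\<rho> / fst u) < 0"
    using assms by (smt (verit) mult_less_cancel_left1)
  then show "FL1_flux a u \<rho> < snd u"
    using r assms by (simp add: FL1_flux_shock mult_neg_pos)
qed (use assms self_in_FL1 in auto)

lemma FL1_flux_le_max:
  assumes "a > 0" "u \<in> Omega" "vel u \<le> a" "\<rho> > 0"
  shows "FL1_flux a u \<rho> \<le> a * fst u * exp (vel u / a - 1)"
proof -
  have R: "fst u > 0" using assms by (simp add: Omega_def)
  have rar: "FL1_flux a u r \<le> a * fst u * exp (vel u / a - 1)" if r: "0 < r" "r \<le> fst u" for r
  proof -
    \<comment> \<open>The density relative to the sonic point of the rarefaction branch, where the
      velocity is \<open>a\<close>. The flow becomes the claimed maximum times
      \<open>y * (1 - ln y)\<close>, which is at most \<open>1\<close>.\<close>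
    define y where "y = r / (fst u * exp (vel u / a - 1))"
    have y: "y > 0" "r = y * (fst u * exp (vel u / a - 1))" using r R by (auto simp: y_def)
    have "ln (r / fst u) = ln y + vel u / a - 1"
      using y R by (simp add: ln_mult)
    then have *: "lax_profile (r / fst u) = ln y + vel u / a - 1"
      using r R by (simp add: lax_profile_def)
    have "vel u - a * lax_profile (r / fst u) = a * (1 - ln y)"
      unfolding * using assms(1) by (simp add: field_simps)
    then have "FL1_flux a u r = a * fst u * exp (vel u / a - 1) * (y * (1 - ln y))"
      unfolding FL1_flux_def using y(2) by simp
    moreover have "y * (1 - ln y) \<le> 1"
    proof -
      have "ln (1 / y) \<le> 1 / y - 1" using y by (intro ln_le_minus_one) simp
      then have "y * ln (1 / y) \<le> y * (1 / y - 1)" using y by (intro mult_left_mono) auto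
      then show ?thesis using y by (simp add: ln_div algebra_simps)
    qed
    ultimately show ?thesis using mult_left_mono[of "y * (1 - ln y)" 1 "a * fst u * exp (vel u / a - 1)"]
      assms R by simp
  qed
  show ?thesis
  proof (cases "\<rho> \<le> fst u")
    case False
    have "sqrt (\<rho> / fst u) > 1" using False R by simp
    then have "vel u - a * sqrt (\<rho> / fst u) \<le> 0"
      using assms by (smt (verit) mult_less_cancel_left1)
    then have "(vel u - a * sqrt (\<rho> / fst u)) * (\<rho> - fst u) \<le> 0"
      using False by (intro mult_nonpos_nonneg) auto
    then have "FL1_flux a u \<rho> \<le> FL1_flux a u (fst u)"
      using False assms R self_in_FL1[of u a] by (simp add: FL1_flux_shock FL1_iff_flux)
    then show ?thesis using rar[of "fst u"] R by simp
  qed (use rar assms in auto)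
qed

lemma FL1_flux_max:
  assumes "a > 0" "u \<in> Omega" "vel u \<le> a"
  shows "FL1_flux a u (fst u * exp (vel u / a - 1)) = a * fst u * exp (vel u / a - 1)"
  using assms by (simp add: FL1_flux_def lax_profile_def Omega_def field_simps)

lemma Q_max_subsonic:
  assumes "a > 0" "u \<in> Omega" "vel u \<le> a"
  shows "Q_max a u = a * fst u * exp (vel u / a - 1)"
proof -
  let ?M = "a * fst u * exp (vel u / a - 1)" and ?r = "fst u * exp (vel u / a - 1)"
  have in_FL1: "(?r, ?M) \<in> FL1 a u"
    using assms FL1_flux_max[OF assms] by (simp add: FL1_iff_flux) (simp add: Omega_def)
  have le: "snd x \<le> ?M" if "x \<in> FL1 a u" for x
    using that FL1_flux_le_max[OF assms] assms(2) by (simp add: FL1_iff_flux)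
  have "is_arg_max snd (\<lambda>x. x \<in> FL1 a u) (?r, ?M)"
    unfolding is_arg_max_def using in_FL1 le by force
  \<comment> \<open>\<open>u_bar\<close> is some maximizer; comparison with the sonic point fixes
    its second component, which is all that is needed.\<close>
  then have "is_arg_max snd (\<lambda>x. x \<in> FL1 a u) (u_bar a u)"
    unfolding u_bar_def arg_max_on_def arg_max_def by (rule someI)
  then have "snd (u_bar a u) = ?M"
    unfolding is_arg_max_def using in_FL1 le by (metis antisym_conv2 snd_conv)
  then show ?thesis using assms(3) by (simp add: Q_max_def)
qed

lemma Q_max_supersonic: "vel u > a \<Longrightarrow> Q_max a u = snd u"
  by (simp add: Q_max_def)

lemma snd_le_Q_max:
  assumes "a > 0" "u \<in> Omega"
  shows "snd u \<le> Q_max a u"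
proof (cases "vel u \<le> a")
  case True
  have "snd u = FL1_flux a u (fst u)" "fst u > 0"
    using self_in_FL1 assms by (auto simp: FL1_iff_flux)
  then show ?thesis using FL1_flux_le_max Q_max_subsonic assms True by simp
qed (simp add: Q_max_supersonic)

lemma u_hat_exists_le_Q_max:
  assumes "a > 0" "u \<in> Omega" "q \<le> Q_max a u"
  obtains w where "u_hat a q u = w" "w \<in> FL1 a u" "snd w = q"
    "\<And>\<rho>. \<rho> > fst w \<Longrightarrow> FL1_flux a u \<rho> < q"
proof -
  have "\<exists>c > 0. FL1_flux a u c \<ge> q"
  proof (cases "vel u \<le> a")
    case True
    then show ?thesis using FL1_flux_max Q_max_subsonic assms
      by (intro exI[of _ "fst u * exp (vel u / a - 1)"]) (simp add: Omega_def)
  next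
    case False
    then show ?thesis using assms self_in_FL1[of u a]
      by (intro exI[of _ "fst u"]) (simp add: Q_max_supersonic FL1_iff_flux)
  qed
  then show thesis using u_hat_exists[OF assms(1,2)] that by metis
qed

section \<open>The left trace\<close>

text \<open>The density \<open>r\<close> makes the shock speed
  \<open>vel u - a * sqrt (r / fst u)\<close> vanish, so the flow is the same on both sides.\<close>

lemma supersonic_stationary_shock:
  assumes "a > 0" "u \<in> Omega" "vel u > a"
  defines "r \<equiv> fst u * (vel u / a)\<^sup>2"
  shows "r > fst u" "sqrt (r / fst u) = vel u / a" "FL1_flux a u r = snd u"
proof -
  have R: "fst u > 0" "vel u / a > 1" using assms by (auto simp: Omega_def)
  have "(vel u / a)\<^sup>2 > 1" using R(2) by (rule one_less_power) simp
  then show "r > fst u" using R by (simp add: r_def)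
  have "r / fst u = (vel u / a)\<^sup>2" using R(1) by (simp add: r_def)
  then show eq: "sqrt (r / fst u) = vel u / a" using R(2) by (simp only: real_sqrt_abs)
  show "FL1_flux a u r = snd u"
    using FL1_flux_shock[OF assms(2) \<open>r > fst u\<close>, of a] eq assms by simp
qed

text \<open>The state \<open>u_hat\<close> lies behind the stationary shock, whose jump sits at
  \<open>\<xi> = 0\<close>; only \<open>u\<close> is visible for negative
  \<open>\<xi>\<close>.\<close>

lemma RS_p_supersonic:
  assumes "a > 0" "u \<in> Omega" "vel u > a" "\<xi> < 0"
  shows "RS_p a u (u_hat a (snd u) u) \<xi> = u"
proof -
  define r where "r = fst u * (vel u / a)\<^sup>2"
  note r = supersonic_stationary_shock[OF assms(1-3), folded r_def]
  have R: "fst u > 0" using assms by (simp add: Omega_def)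
  let ?w = "(r, snd u)"
  have w: "?w \<in> FL1 a u" using r R assms by (simp add: FL1_iff_flux)
  have "u_hat a (snd u) u = ?w"
  proof (rule u_hat_eqI)
    fix \<rho> assume \<rho>: "\<rho> > fst ?w"
    then have "sqrt (\<rho> / fst u) > vel u / a"
      using R unfolding r(2)[symmetric] by (simp add: divide_strict_right_mono)
    then have "vel u - a * sqrt (\<rho> / fst u) < 0" using assms by (simp add: field_simps)
    then show "FL1_flux a u \<rho> < snd u"
      using \<rho> r(1) assms by (simp add: FL1_flux_shock mult_neg_pos)
  qed (use w assms in auto)
  then show ?thesis using RS_p_one_wave[OF assms(1,2) w] r assms by simp
qed

text \<open>At a supersonic \<open>w\<close> the flow would return to at least \<open>snd w\<close>
  at some larger density: across the stationary shock if \<open>w = u\<close>, further along the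
  rarefaction branch otherwise. This contradicts \<open>last\<close>.\<close>

lemma u_hat_rarefaction_subsonic:
  assumes "a > 0" "u \<in> Omega" "w \<in> FL1 a u" "fst w \<le> fst u"
    and last: "\<And>\<rho>. \<rho> > fst w \<Longrightarrow> FL1_flux a u \<rho> < snd w"
  shows "vel w \<le> a"
proof (rule ccontr)
  assume "\<not> vel w \<le> a"
  then have super: "vel w > a" by simp
  have w: "w \<in> Omega" "snd w = FL1_flux a u (fst w)"
    and vel: "vel w = vel u - a * lax_profile (fst w / fst u)"
    using assms(3) FL1_iff_vel[OF assms(2), of w a] FL1_iff_flux[OF assms(2), of w a] by blast+
  have R: "fst w > 0" "fst u > 0" using w assms by (auto simp: Omega_def)
  show False
  proof (cases "fst w = fst u")
    case True
    with vel R have "w = u" by (intro state_eqI) (auto simp: lax_profile_def w)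
    then show False
      using supersonic_stationary_shock[OF assms(1,2)] super last by fastforce
  next
    case False
    \<comment> \<open>The first bound keeps \<open>fst w * x\<close> on the rarefaction branch; the
      second keeps \<open>vel w - a * x\<close> nonnegative, so that \<open>ln x \<le> x - 1\<close>
      suffices to bound the flow from below.\<close>
    define x where "x = min (fst u / fst w) (vel w / a)"
    have x: "x > 1" "x \<le> fst u / fst w" "a * x \<le> vel w"
      using False assms R super by (auto simp: x_def min_def field_simps)
    let ?r = "fst w * x"
    have r: "?r \<le> fst u" "?r > fst w" using x R by (auto simp: field_simps)
    have "ln (?r / fst u) = ln (fst w / fst u) + ln x" using R x by (simp add: ln_mult ln_div)
    moreover have "lax_profile (?r / fst u) = ln (?r / fst u)"
      "lax_profile (fst w / fst u) = ln (fst w / fst u)"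
      using R r assms by (auto simp: lax_profile_def)
    ultimately have "FL1_flux a u ?r = ?r * (vel w - a * ln x)"
      by (simp add: FL1_flux_def vel algebra_simps)
    moreover have "a * ln x \<le> a * (x - 1)" using x assms by (intro mult_left_mono ln_le_minus_one) auto
    ultimately have "FL1_flux a u ?r \<ge> ?r * (vel w - a * (x - 1))"
      using R x by (simp add: mult_left_mono)
    also have "?r * (vel w - a * (x - 1)) = snd w + fst w * ((x - 1) * (vel w - a * x))"
      using snd_eq_fst_vel[OF w(1)] by (simp add: algebra_simps)
    finally have "FL1_flux a u ?r \<ge> snd w" using R x by (smt (verit) mult_nonneg_nonneg)
    then show False using last r by fastforce
  qed
qed

text \<open>In the fan the velocity is \<open>\<xi> + a\<close>, and inverting the logarithmic
  profile yields the density. The explicit form makes the limit at a sonic trace computable.\<close>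

lemma fan_state:
  assumes "a > 0" "u \<in> Omega" "\<xi> \<ge> lambda1 a u"
  defines "r \<equiv> fst u * exp ((vel u - \<xi> - a) / a)"
  shows "(THE w. w \<in> FL1 a u \<and> lambda1 a w = \<xi>) = (r, r * (\<xi> + a))"
proof -
  have R: "fst u > 0" using assms by (simp add: Omega_def)
  have "(vel u - \<xi> - a) / a \<le> 0" using assms by (simp add: lambda1_def divide_nonpos_pos)
  then have "lax_profile (r / fst u) = (vel u - \<xi> - a) / a"
    using R by (simp add: r_def lax_profile_def)
  then have in_FL1: "(r, r * (\<xi> + a)) \<in> FL1 a u"
    using R assms by (simp add: FL1_iff_vel) (simp add: Omega_def vel_def)
  have "r > 0" using R by (simp add: r_def)
  then have vel: "vel (r, r * (\<xi> + a)) = \<xi> + a" by (simp add: vel_def)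
  show ?thesis
  proof (rule the_equality)
    fix w assume w: "w \<in> FL1 a u \<and> lambda1 a w = \<xi>"
    then have "vel w = vel (r, r * (\<xi> + a))" using vel by (simp add: lambda1_def)
    moreover from this have "fst w = fst (r, r * (\<xi> + a))"
      using FL1_vel_antimono[OF assms(1,2)] in_FL1 w by (metis less_irrefl linorder_neqE)
    ultimately show "w = (r, r * (\<xi> + a))" using w assms by (intro state_eqI) (auto simp: FL1_iff_vel)
  qed (use in_FL1 vel in \<open>auto simp: lambda1_def\<close>)
qed

lemma tendsto_at_left_eventually_const:
  fixes f :: "real \<Rightarrow> state"
  assumes "s < b" "\<And>x. s \<le> x \<Longrightarrow> x < b \<Longrightarrow> f x = w"
  shows "(f \<longlongrightarrow> w) (at_left b)"
proof (rule tendsto_eventually)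
  show "eventually (\<lambda>x. f x = w) (at_left b)"
    using assms by (auto simp: eventually_at_left intro!: exI[of _ s])
qed

lemma RS_p_left_trace:
  assumes "a > 0" "u \<in> Omega" "q \<le> Q_max a u"
  defines "w \<equiv> u_hat a q u"
  shows "vel u > a \<and> q = snd u \<or>
    w \<in> FL1 a u \<and> snd w = q \<and> vel w \<le> a \<and> (RS_p a u w \<longlongrightarrow> w) (at_left 0)"
proof -
  have w: "w \<in> FL1 a u" "snd w = q" and last: "\<And>\<rho>. \<rho> > fst w \<Longrightarrow> FL1_flux a u \<rho> < snd w"
    using u_hat_exists_le_Q_max[OF assms(1-3)] unfolding w_def by metis+
  have R: "fst u > 0" and wO: "w \<in> Omega" and vel: "vel w = vel u - a * lax_profile (fst w / fst u)"
    and flux: "snd w = FL1_flux a u (fst w)"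
    using w(1) assms(2) FL1_iff_vel[OF assms(2), of w a] FL1_iff_flux[OF assms(2), of w a]
    unfolding Omega_def by blast+
  note RS = RS_p_one_wave[OF assms(1,2) w(1)]
  show ?thesis
  proof (cases "fst w > fst u")
    case True
    let ?t = "fst w / fst u"
    let ?s = "vel u - a * sqrt ?t"
    have t: "?t > 1" using True R by simp
    show ?thesis
    proof (cases "?s < 0")
      case neg: True
      have "vel w = ?s + a / sqrt ?t" using t vel by (simp add: lax_profile_def algebra_simps)
      also have "\<dots> < a / sqrt ?t" using neg by simp
      also have "\<dots> \<le> a" using t assms by (simp add: divide_le_eq)
      finally have "vel w \<le> a" by simp
      moreover have "(RS_p a u w \<longlongrightarrow> w) (at_left 0)"
        using neg True by (intro tendsto_at_left_eventually_const[of ?s]) (auto simp: RS)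
      ultimately show ?thesis using w by blast
    next
      case False
      have "a * 1 < a * sqrt ?t" using t assms by (intro mult_strict_left_mono) auto
      with False have super: "vel u > a" by linarith
      \<comment> \<open>A nonnegative shock speed gives \<open>q \<ge> snd u\<close>, while
        \<open>Q_max a u = snd u\<close> for supersonic \<open>u\<close>; hence
        \<open>q = snd u\<close>, the first alternative.\<close>
      have "0 \<le> ?s * (fst w - fst u)" using False True by (intro mult_nonneg_nonneg) auto
      then have "q \<ge> snd u"
        using FL1_flux_shock[OF assms(2) True, of a] flux w by simp
      then show ?thesis using super assms(3) by (simp add: Q_max_supersonic)
    qed
  next
    case False
    then have le: "fst w \<le> fst u" by simp
    have sub: "vel w \<le> a"
      by (rule u_hat_rarefaction_subsonic[OF assms(1,2) w(1) le last])
    have "(RS_p a u w \<longlongrightarrow> w) (at_left 0)"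
    proof (cases "fst w = fst u")
      case True
      with vel R have "w = u" by (intro state_eqI) (auto simp: lax_profile_def wO)
      then have "RS_p a u w = (\<lambda>_. w)" using assms by (simp add: fun_eq_iff RS_p_same)
      then show ?thesis by simp
    next
      case neq: False
      then have less: "lambda1 a u < lambda1 a w"
        using le FL1_vel_antimono[OF assms(1,2) w(1) self_in_FL1[OF assms(2)]]
        by (simp add: lambda1_def)
      show ?thesis
      proof (cases "lambda1 a w = 0")
        \<comment> \<open>The fan extends up to \<open>\<xi> = 0\<close>, so the solution is not
          eventually constant and the trace is a genuine limit of fan states.\<close>
        case True
        let ?r = "\<lambda>\<xi>. fst u * exp ((vel u - \<xi> - a) / a)"
        have "eventually (\<lambda>\<xi>. lambda1 a u < \<xi> \<and> \<xi> < 0) (at_left (0::real))"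
          using less True by (auto simp: eventually_at_left intro!: exI[of _ "lambda1 a u"])
        then have ev: "eventually (\<lambda>\<xi>. (?r \<xi>, ?r \<xi> * (\<xi> + a)) = RS_p a u w \<xi>) (at_left 0)"
          by eventually_elim (use False True less in \<open>simp add: RS fan_state[OF assms(1,2)]\<close>)
        have "ln (fst w / fst u) = (vel u - a) / a"
          using True vel le R assms by (simp add: lambda1_def lax_profile_def field_simps)
        then have "exp ((vel u - a) / a) = fst w / fst u"
          using R wO by (metis Omega_def divide_pos_pos exp_ln mem_Collect_eq)
        then have "fst w = ?r 0" using R by simp
        moreover have "vel w = a" using True by (simp add: lambda1_def)
        ultimately have "w = (?r 0, ?r 0 * (0 + a))"
          using snd_eq_fst_vel[OF wO] by (simp add: prod_eq_iff)
        moreover have "((\<lambda>\<xi>. (?r \<xi>, ?r \<xi> * (\<xi> + a))) \<longlongrightarrow> (?r 0, ?r 0 * (0 + a))) (at_left 0)"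
          using assms(1) by (intro tendsto_intros) auto
        ultimately show ?thesis using Lim_transform_eventually[OF _ ev] by simp
      next
        case nz: False
        with sub have "lambda1 a w < 0" by (simp add: lambda1_def)
        then show ?thesis using False less
          by (intro tendsto_at_left_eventually_const[of "lambda1 a w"]) (auto simp: RS)
      qed
    qed
    then show ?thesis using w sub by blast
  qed
qed

section \<open>The coherence threshold\<close>

lemma cubic_threshold:
  obtains x1 :: real where "0 < x1" "x1\<^sup>2 + x1 < 1" "x1 - x1 ^ 3 = 1 / exp 1"
    "\<And>x. 0 < x \<Longrightarrow> x\<^sup>2 + x < 1 \<Longrightarrow> x - x ^ 3 < 1 / exp 1 \<longleftrightarrow> x < x1"
    "\<And>x. 0 < x \<Longrightarrow> x\<^sup>2 + x < 1 \<Longrightarrow> x - x ^ 3 = 1 / exp 1 \<Longrightarrow> x = x1"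
proof -
  let ?k = "\<lambda>x::real. x - x ^ 3"
  \<comment> \<open>The fourth power of this Taylor bound gives \<open>exp 1 > 8 / 3\<close>, and
    \<open>3 / 8\<close> is the value of \<open>?k\<close> at \<open>1 / 2\<close>; the root
    therefore lies in \<open>{0..1 / 2}\<close>.\<close>
  have "exp (1 / 4 :: real) \<ge> 41 / 32"
    using exp_lower_Taylor_quadratic[of "1 / 4 :: real"] by (simp add: power2_eq_square)
  then have "exp (1 / 4 :: real) ^ 4 \<ge> (41 / 32) ^ 4" by (intro power_mono) auto
  moreover have "exp (1 / 4 :: real) ^ 4 = exp 1" by (simp flip: exp_of_nat_mult)
  ultimately have e: "1 / exp 1 < (3 / 8 :: real)" by (simp add: field_simps)
  obtain x1 where x1: "0 \<le> x1" "x1 \<le> 1 / 2" "?k x1 = 1 / exp 1"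
    using IVT'[of ?k 0 "1 / exp 1" "1 / 2"] e
    by (force intro!: continuous_intros simp: power3_eq_cube)
  have "x1 \<noteq> 0" using x1(3) by auto
  have "x1\<^sup>2 \<le> 1 / 4" using x1 power_mono[of x1 "1 / 2" 2] by (simp add: power2_eq_square)
  show thesis
  proof
    show "0 < x1" "x1\<^sup>2 + x1 < 1" "?k x1 = 1 / exp 1"
      using x1 \<open>x1 \<noteq> 0\<close> \<open>x1\<^sup>2 \<le> 1 / 4\<close> by auto
    fix x :: real assume x: "0 < x" "x\<^sup>2 + x < 1"
    \<comment> \<open>A rational bound just above the positive root of
      \<open>x\<^sup>2 + x = 1\<close>. It makes the cofactor of \<open>x - x1\<close> in
      \<open>?k x - ?k x1\<close> positive.\<close>
    have "x < 31 / 50"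
    proof (rule ccontr)
      assume "\<not> x < 31 / 50"
      then show False using x power_mono[of "31 / 50" x 2] by (simp add: power2_eq_square)
    qed
    then have "x\<^sup>2 \<le> (31 / 50)\<^sup>2" using x by (intro power_mono) auto
    moreover have "x * x1 \<le> 31 / 50 * (1 / 2)" using x x1 \<open>x < 31 / 50\<close> by (intro mult_mono) auto
    ultimately have "1 - x\<^sup>2 - x * x1 - x1\<^sup>2 > 0"
      using \<open>x1\<^sup>2 \<le> 1 / 4\<close> by (simp add: power2_eq_square)
    moreover have "?k x - 1 / exp 1 = (x - x1) * (1 - x\<^sup>2 - x * x1 - x1\<^sup>2)"
      unfolding x1(3)[symmetric] by algebra
    ultimately show "?k x < 1 / exp 1 \<longleftrightarrow> x < x1" "?k x = 1 / exp 1 \<Longrightarrow> x = x1"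
      by (smt (verit) mult_neg_pos mult_nonneg_nonneg, simp)
  qed
qed

lemma lax_S_at_rest:
  assumes "R > 0" "\<rho> > 0"
  shows "lax_S a 1 (R, 0) \<rho> = a * R * (sqrt (\<rho> / R) - sqrt (\<rho> / R) ^ 3)"
    and "lax_S a 1 (R, 0) \<rho> / \<rho> = a * (1 / sqrt (\<rho> / R) - sqrt (\<rho> / R))"
proof -
  define x where "x = sqrt (\<rho> / R)"
  have x: "x > 0" "\<rho> = R * x\<^sup>2" using assms by (auto simp: x_def)
  have "sqrt (R / \<rho>) = 1 / x" unfolding x_def by (rule sqrt_flip)
  then have *: "lax_S a 1 (R, 0) \<rho> = \<rho> * (a * (1 / x - x))"
    by (simp add: lax_S_def x_def algebra_simps)
  then show "lax_S a 1 (R, 0) \<rho> / \<rho> = a * (1 / sqrt (\<rho> / R) - sqrt (\<rho> / R))"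
    using assms by (simp add: x_def)
  show "lax_S a 1 (R, 0) \<rho> = a * R * (sqrt (\<rho> / R) - sqrt (\<rho> / R) ^ 3)"
    unfolding * x_def[symmetric] using x
    by (simp add: field_simps power2_eq_square power3_eq_cube)
qed

text \<open>The left side says that the velocity \<open>a * (1 / x - x)\<close> is
  supersonic.\<close>

lemma inverse_diff_gt_one_iff:
  fixes x :: real
  assumes "x > 0"
  shows "1 / x - x > 1 \<longleftrightarrow> x\<^sup>2 + x < 1"
  using assms by (auto simp: field_simps power2_eq_square)

text \<open>With \<open>x\<close> the square root of the density relative to \<open>u_star0\<close>,
  whose density \<open>R\<close> satisfies \<open>a * R = exp 1 * qs\<close>, the equation for flow
  \<open>qs\<close> is \<open>x - x ^ 3 = 1 / exp 1\<close>. The supersonic condition selects the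
  root \<open>x1\<close>.\<close>

lemma vel_u_star_sup:
  assumes "a > 0" "qs > 0"
  obtains x1 where "0 < x1" "x1\<^sup>2 + x1 < 1" "vel (u_star_sup a qs) = a * (1 / x1 - x1)"
    "\<And>x. 0 < x \<Longrightarrow> x\<^sup>2 + x < 1 \<Longrightarrow> x - x ^ 3 < 1 / exp 1 \<longleftrightarrow> x < x1"
proof -
  obtain x1 :: real where root: "0 < x1" "x1\<^sup>2 + x1 < 1" "x1 - x1 ^ 3 = 1 / exp 1"
    and sign: "\<And>x. 0 < x \<Longrightarrow> x\<^sup>2 + x < 1 \<Longrightarrow> x - x ^ 3 < 1 / exp 1 \<longleftrightarrow> x < x1"
    and uniq: "\<And>x. 0 < x \<Longrightarrow> x\<^sup>2 + x < 1 \<Longrightarrow> x - x ^ 3 = 1 / exp 1 \<Longrightarrow> x = x1"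
    using cubic_threshold by blast
  define R where "R = exp 1 * qs / a"
  have R: "R > 0" "a * R = exp 1 * qs" using assms by (auto simp: R_def)
  have "x1 < 1" using root(2) by (smt (verit) zero_le_power2)
  then have x1: "x1\<^sup>2 < 1" using root(1) by (simp add: power_less_one_iff)
  let ?w = "(R * x1\<^sup>2, qs)"
  have sq: "sqrt (R * x1\<^sup>2 / R) = x1" using R root by simp
  have pos: "R * x1\<^sup>2 > 0" using R root by simp
  have S: "lax_S a 1 (R, 0) (R * x1\<^sup>2) = qs"
    unfolding lax_S_at_rest(1)[OF R(1) pos] sq root(3) R(2) by simp
  have vel: "vel ?w = a * (1 / x1 - x1)"
    using lax_S_at_rest(2)[OF R(1) pos, of a] unfolding sq S by (simp add: vel_def)
  have "1 / x1 - x1 > 1" using inverse_diff_gt_one_iff[OF root(1)] root(2) by simp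
  then have "vel ?w > a" using vel assms by simp
  have "u_star_sup a qs = ?w"
    unfolding u_star_sup_def u_star0_def R_def[symmetric]
  proof (rule the_equality)
    show "0 < fst ?w \<and> fst ?w < R \<and> snd ?w = lax_S a 1 (R, 0) (fst ?w) \<and> snd ?w = qs \<and> \<bar>vel ?w\<bar> > a"
      using pos x1 R S \<open>vel ?w > a\<close> by auto
  next
    fix u
    assume u: "0 < fst u \<and> fst u < R \<and> snd u = lax_S a 1 (R, 0) (fst u) \<and> snd u = qs \<and> \<bar>vel u\<bar> > a"
    define x where "x = sqrt (fst u / R)"
    have x: "x > 0" using u R by (simp add: x_def)
    \<comment> \<open>Positive flow removes the absolute value from the supersonic
      condition.\<close>
    have "vel u > 0" using u assms by (simp add: vel_def)
    moreover have "vel u = lax_S a 1 (R, 0) (fst u) / fst u" using u by (simp add: vel_def)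
    then have "vel u = a * (1 / x - x)" using u lax_S_at_rest(2)[OF R(1)] by (simp add: x_def)
    ultimately have "a * (1 / x - x) > a * 1" using u by simp
    then have "1 / x - x > 1" using assms by (simp only: mult_less_cancel_left_pos)
    moreover have "lax_S a 1 (R, 0) (fst u) = qs" using u by simp
    then have "qs = a * R * (x - x ^ 3)"
      using u lax_S_at_rest(1)[OF R(1), of "fst u" a] by (simp add: x_def)
    then have "qs = exp 1 * qs * (x - x ^ 3)" using R(2) by simp
    then have "qs * (exp 1 * (x - x ^ 3)) = qs * 1" by (metis mult.assoc mult.commute mult_1_right)
    then have "exp 1 * (x - x ^ 3) = 1" using assms(2) by (simp only: mult_cancel_left) simp
    then have "x - x ^ 3 = 1 / exp 1" by (simp add: eq_divide_eq mult.commute)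
    ultimately have "x = x1" using uniq x inverse_diff_gt_one_iff by blast
    then have "fst u = R * x1\<^sup>2" using R u by (auto simp: x_def)
    with u show "u = ?w" by (simp add: prod_eq_iff)
  qed
  with vel root sign show thesis by (intro that) auto
qed

text \<open>At rest the maximal flow is \<open>a * fst w / exp 1\<close>. For
  \<open>vel u \<le> a\<close> it is at most \<open>Q_max a u\<close>, as the shock profile
  dominates the logarithm. For supersonic \<open>u\<close>, a density
  \<open>fst w \<ge> exp 1 * qs / a\<close> would force \<open>u\<close> into
  \<open>CHl_compl\<close> or its flow up to \<open>qs\<close>.\<close>

lemma Q_max_rest_state_less:
  assumes "a > 0" "qs > 0" "u \<in> CHl a qs" "Q_max a u < qs" "w \<in> FL1 a u" "snd w = 0"
  shows "Q_max a w < qs" "w \<in> CHl a qs"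
proof -
  obtain x1 where x1: "0 < x1" "x1\<^sup>2 + x1 < 1"
    and sup: "vel (u_star_sup a qs) = a * (1 / x1 - x1)"
    and sign: "\<And>x. 0 < x \<Longrightarrow> x\<^sup>2 + x < 1 \<Longrightarrow> x - x ^ 3 < 1 / exp 1 \<longleftrightarrow> x < x1"
    using vel_u_star_sup[OF assms(1,2)] by blast
  have uO: "u \<in> Omega" using assms(3) by (simp add: CHl_def)
  have wO: "w \<in> Omega" and vw: "vel w = 0"
    and vel: "vel u = a * lax_profile (fst w / fst u)"
    using assms(5,6) FL1_iff_vel[OF uO] by (auto simp: vel_def)
  have R: "fst u > 0" "fst w > 0" using uO wO by (auto simp: Omega_def)
  have "1 / x1 - x1 > 1" using inverse_diff_gt_one_iff[OF x1(1)] x1(2) by simp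
  then have "a * (1 / x1 - x1) > 0" using assms by simp
  then show "w \<in> CHl a qs" using wO vw sup by (simp add: CHl_def CHl_compl_def)
  have Qw: "Q_max a w = a * fst w / exp 1"
    using Q_max_subsonic[OF assms(1) wO] vw assms by (simp add: exp_minus divide_inverse)
  show "Q_max a w < qs"
  proof (cases "vel u \<le> a")
    case True
    have "ln (fst w / fst u) \<le> lax_profile (fst w / fst u)"
      using ln_le_sqrt_diff[of "fst w / fst u"] by (simp add: lax_profile_def)
    also have "\<dots> = vel u / a" using vel assms by simp
    finally have "exp (ln (fst w / fst u)) \<le> exp (vel u / a)" by simp
    then have "fst w / fst u \<le> exp (vel u / a)" using R by simp
    then have "fst w \<le> fst u * exp (vel u / a)" using R by (simp add: field_simps)
    then have "a * fst w / exp 1 \<le> a * (fst u * exp (vel u / a)) / exp 1"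
      using assms by (intro divide_right_mono mult_left_mono) auto
    also have "\<dots> = Q_max a u"
      using Q_max_subsonic[OF assms(1) uO True] by (simp add: exp_diff)
    finally show ?thesis using Qw assms by simp
  next
    case False
    then have super: "vel u > a" by simp
    then have qu: "snd u < qs" using assms by (simp add: Q_max_supersonic)
    define R0 where "R0 = exp 1 * qs / a"
    have R0: "R0 > 0" "a * R0 = exp 1 * qs" using assms by (auto simp: R0_def)
    have "lax_profile (fst w / fst u) > 0" using vel super assms by (smt (verit) mult_nonneg_nonpos)
    then have t: "fst w / fst u > 1" using R by (auto simp: lax_profile_def not_le split: if_splits)
    define x where "x = sqrt (fst u / fst w)"
    have x: "x > 0" using R by (simp add: x_def)
    have vx: "vel u = a * (1 / x - x)"
      using vel t sqrt_flip[of "fst u" "fst w"] by (simp add: lax_profile_def x_def)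
    have "fst u = fst w * x\<^sup>2" using R by (simp add: x_def)
    then have "snd u = fst w * x\<^sup>2 * (a * (1 / x - x))" using snd_eq_fst_vel[OF uO] vx by simp
    also have "\<dots> = a * fst w * (x - x ^ 3)"
      using x by (simp add: field_simps power2_eq_square power3_eq_cube)
    finally have qx: "snd u = a * fst w * (x - x ^ 3)" .
    have "a * (1 / x - x) > a * 1" using super vx by simp
    then have x1': "x\<^sup>2 + x < 1" using x assms
      by (simp only: mult_less_cancel_left_pos flip: inverse_diff_gt_one_iff)
    have "fst w < R0"
    proof (rule ccontr)
      assume ge: "\<not> fst w < R0"
      have "u \<notin> CHl_compl a qs" using assms(3) by (simp add: CHl_def)
      then consider "vel u \<le> vel (u_star_sup a qs)" | "snd u < lax_S a 1 (R0, 0) (fst u)"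
        using uO qu by (fastforce simp: CHl_compl_def u_star0_def R0_def)
      then show False
      proof cases
        \<comment> \<open>A velocity at most the threshold means \<open>x \<ge> x1\<close>, hence
          \<open>x - x ^ 3 \<ge> 1 / exp 1\<close> and \<open>snd u \<ge> qs\<close>.\<close>
        case 1
        then have "1 / x - x \<le> 1 / x1 - x1" using sup vx assms by simp
        moreover have "1 / x - x > 1 / x1 - x1" if "x < x1"
          using that x by (smt (verit) frac_less2)
        ultimately have "x \<ge> x1" by force
        then have "x - x ^ 3 \<ge> 1 / exp 1" using sign[OF x x1'] by simp
        then have "a * R0 * (1 / exp 1) \<le> a * fst w * (x - x ^ 3)"
          using ge assms R0 by (intro mult_mono) auto
        then show False using qu qx R0 by simp
      next
        \<comment> \<open>At density \<open>fst u\<close>, the shock curve through the rest state of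
          density \<open>R0\<close> has velocity \<open>a * (1 / y - y)\<close> with
          \<open>y = sqrt (fst u / R0) \<ge> x\<close>. This is at most \<open>vel u\<close>, so
          \<open>u\<close> cannot lie below that curve.\<close>
        case 2
        have "vel u < lax_S a 1 (R0, 0) (fst u) / fst u"
          using 2 R by (simp add: vel_def divide_strict_right_mono)
        then have "a * (1 / x - x) < a * (1 / sqrt (fst u / R0) - sqrt (fst u / R0))"
          using lax_S_at_rest(2)[OF R0(1) R(1)] vx by simp
        moreover have "x \<le> sqrt (fst u / R0)" using ge R R0 by (simp add: x_def frac_le)
        then have "1 / sqrt (fst u / R0) - sqrt (fst u / R0) \<le> 1 / x - x"
          using x by (smt (verit) frac_le)
        ultimately show False using assms by (smt (verit) mult_left_mono)
      qed
    qed
    then have "a * fst w < a * R0" using assms by simp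
    then show ?thesis using Qw R0 by (simp add: divide_less_eq mult.commute)
  qed
qed

lemma CHl_compl_supersonic:
  assumes "a > 0" "qs > 0" "u \<in> CHl_compl a qs"
  shows "vel u > a"
proof -
  obtain x1 where x1: "0 < x1" "x1\<^sup>2 + x1 < 1" "vel (u_star_sup a qs) = a * (1 / x1 - x1)"
    using vel_u_star_sup[OF assms(1,2)] by blast
  have "a * 1 < a * (1 / x1 - x1)"
    using inverse_diff_gt_one_iff[OF x1(1)] x1(2) assms(1) by (intro mult_strict_left_mono) simp_all
  then show ?thesis using x1(3) assms(3) by (simp add: CHl_compl_def)
qed

section \<open>Invariance of the flow \<open>Q_h\<close> and coherence\<close>

lemma Q_h_CHl_compl:
  assumes "a > 0" "qs > 0" "u \<in> CHl_compl a qs"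
  shows "Q_h a qs u = snd u" "0 < snd u" "snd u < qs"
proof -
  have v: "vel u > a" by (rule CHl_compl_supersonic[OF assms])
  have u: "u \<in> Omega" "snd u < qs" using assms(3) by (auto simp: CHl_compl_def)
  then show "Q_h a qs u = snd u" "snd u < qs"
    using v assms(3) by (simp_all add: Q_h_def Q_max_supersonic CHl_def)
  show "0 < snd u" using u v assms(1) snd_eq_fst_vel[of u] by (simp add: Omega_def)
qed

lemma Q_h_bounds:
  assumes "a > 0" "qs > 0" "u \<in> Omega"
  shows "0 \<le> Q_h a qs u" "Q_h a qs u \<le> Q_max a u"
proof -
  have "0 \<le> Q_max a u"
  proof (cases "vel u \<le> a")
    case False
    then show ?thesis using assms snd_eq_fst_vel[of u] by (simp add: Q_max_supersonic Omega_def)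
  qed (use assms in \<open>simp add: Q_max_subsonic Omega_def\<close>)
  moreover have "u \<in> CHl a qs \<or> u \<in> CHl_compl a qs" using assms by (simp add: CHl_def)
  ultimately show "0 \<le> Q_h a qs u" "Q_h a qs u \<le> Q_max a u"
    using Q_h_CHl_compl[OF assms(1,2), of u] snd_le_Q_max[OF assms(1,3)] assms(2)
    by (auto simp: Q_h_def)
qed

text \<open>The last hypothesis excludes the stationary-shock alternative, in which the trace is
  \<open>u\<close> rather than \<open>w\<close>. It rules out \<open>CHl_compl\<close>, whose states
  are supersonic with \<open>Q_h\<close> equal to their own flow; flow \<open>qs\<close> persists
  because \<open>snd w \<le> Q_max a w\<close>.\<close>

lemma Q_h_u_hat:
  assumes "a > 0" "qs > 0" "u \<in> Omega" "w \<in> FL1 a u" "snd w = Q_h a qs u"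
    and "vel u \<le> a \<or> snd u \<noteq> Q_h a qs u"
  shows "Q_h a qs w = snd w"
proof -
  have w: "w \<in> Omega" using assms by (simp add: FL1_iff_vel)
  consider "Q_max a u \<ge> qs" | "Q_max a u < qs" "u \<in> CHl a qs" | "u \<in> CHl_compl a qs"
    using assms(3) by (force simp: CHl_def)
  then show ?thesis
  proof cases
    case 1
    then show ?thesis using snd_le_Q_max[OF assms(1) w] assms(5) by (simp add: Q_h_def)
  next
    case 2
    then have "snd w = 0" using assms(5) by (simp add: Q_h_def)
    then show ?thesis using Q_max_rest_state_less[OF assms(1,2) 2(2,1) assms(4)] by (simp add: Q_h_def)
  next
    case 3
    then show ?thesis
      using assms(6) Q_h_CHl_compl[OF assms(1,2) 3] CHl_compl_supersonic[OF assms(1,2) 3] by simp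
  qed
qed

lemma RS_h_coherent:
  assumes "a > 0" "qs > 0" "ul \<in> Omega" "ur \<in> Omega"
  shows "coherent_at (RS_h a qs) ul ur"
proof -
  let ?q = "Q_h a qs ul"
  have q: "0 \<le> ?q" "?q \<le> Q_max a ul" using Q_h_bounds[OF assms(1-3)] by auto
  obtain up s where up: "up \<in> Omega" "snd up = ?q" "s > 0"
    and right: "\<And>\<xi>. 0 \<le> \<xi> \<Longrightarrow> \<xi> < s \<Longrightarrow> RS_h a qs ul ur \<xi> = up"
    using RS_c_at_zero_plus[of a ur "\<lambda>ul ur. Q_h a qs ul", OF assms(1,4) q(1)]
    unfolding RS_h_def by blast
  have right_lim: "(RS_h a qs ul ur \<longlongrightarrow> up) (at_right 0)"
  proof (rule tendsto_eventually)
    show "eventually (\<lambda>x. RS_h a qs ul ur x = up) (at_right 0)"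
      using right up(3) by (auto simp: eventually_at_right intro!: exI[of _ s])
  qed
  have left: "RS_h a qs ul ur \<xi> = RS_p a ul (u_hat a ?q ul) \<xi>" if "\<xi> < 0" for \<xi>
    using that by (simp add: RS_h_def RS_c_def)
  \<comment> \<open>The left trace must reproduce the flow \<open>?q\<close> and be stationary under
    the left half of the solver. It is \<open>ul\<close> in the stationary-shock case and
    \<open>u_hat a ?q ul\<close> otherwise.\<close>
  have "\<exists>um\<in>Omega. (RS_p a ul (u_hat a ?q ul) \<longlongrightarrow> um) (at_left 0) \<and> Q_h a qs um = ?q \<and>
    (\<forall>\<xi><0. RS_p a um (u_hat a ?q um) \<xi> = um)"
  proof (cases "vel ul > a \<and> ?q = snd ul")
    case True
    then have const: "RS_p a ul (u_hat a ?q ul) \<xi> = ul" if "\<xi> < 0" for \<xi>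
      using RS_p_supersonic[of a ul] assms that by simp
    then have "(RS_p a ul (u_hat a ?q ul) \<longlongrightarrow> ul) (at_left 0)"
      by (intro tendsto_at_left_eventually_const[of "-1"]) auto
    with const assms show ?thesis by blast
  next
    case False
    let ?w = "u_hat a ?q ul"
    have w: "?w \<in> FL1 a ul" "snd ?w = ?q" "vel ?w \<le> a" "(RS_p a ul ?w \<longlongrightarrow> ?w) (at_left 0)"
      using RS_p_left_trace[OF assms(1,3) q(2)] False by auto
    then have wO: "?w \<in> Omega" using assms by (simp add: FL1_iff_vel)
    have "Q_h a qs ?w = ?q"
      using Q_h_u_hat[OF assms(1-3) w(1,2)] False w(2) by auto
    moreover have "u_hat a ?q ?w = ?w" using u_hat_subsonic_self[OF assms(1) wO w(3)] w(2) by simp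
    ultimately show ?thesis
      using w(4) wO RS_p_same[OF assms(1) wO] by (intro bexI[of _ ?w]) auto
  qed
  then obtain um where um: "um \<in> Omega" "(RS_p a ul (u_hat a ?q ul) \<longlongrightarrow> um) (at_left 0)"
    "Q_h a qs um = ?q" and stat: "\<And>\<xi>. \<xi> < 0 \<Longrightarrow> RS_p a um (u_hat a ?q um) \<xi> = um"
    by blast
  have "eventually (\<lambda>\<xi>. RS_p a ul (u_hat a ?q ul) \<xi> = RS_h a qs ul ur \<xi>) (at_left 0)"
    using left by (auto simp: eventually_at_filter)
  then have left_lim: "(RS_h a qs ul ur \<longlongrightarrow> um) (at_left 0)"
    by (rule Lim_transform_eventually[OF um(2)])
  have "u_check a ?q up = up"
    using u_check_eqI[OF assms(1) up(1) self_in_BL2[OF up(1)]] up(2) q(1) by simp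
  then have "RS_h a qs um up \<xi> = (if \<xi> < 0 then um else up)" for \<xi>
    using stat RS_p_same[OF assms(1) up(1)] um(3) by (simp add: RS_h_def RS_c_def)
  moreover have "(um, up) \<in> D" using um(1) up(1) by (simp add: D_def)
  ultimately show ?thesis
    unfolding coherent_at_def using left_lim right_lim by blast
qed

theorem proposition3p3:
  fixes a qs :: real
  assumes "a > 0" and "qs > 0"
  shows "(\<forall>ul\<in>Omega. \<forall>ur\<in>Omega.
            ((ul, ur) \<in> CHl a qs \<times> Omega \<longrightarrow> RS_h a qs ul ur = RS_v a qs ul ur) \<and>
            ((ul, ur) \<in> CHl_compl a qs \<times> Omega \<longrightarrow>
               (\<forall>\<xi>. RS_h a qs ul ur \<xi> =
                  (if \<xi> < 0 then ul else RS_p a (u_check a (snd ul) ur) ur \<xi>)) \<and>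
               (\<forall>RS. c_Riemann_solver a RS \<longrightarrow>
                  snd (RS ul ur 0) \<le> snd (RS_h a qs ul ur 0)) \<and>
               snd (RS_h a qs ul ur 0) \<in> {0<..<qs})) \<and>
         (\<forall>(ul, ur)\<in>D. coherent_at (RS_h a qs) ul ur)"
proof (intro conjI ballI impI)
  fix ul ur assume "(ul, ur) \<in> CHl a qs \<times> Omega"
  then have "Q_h a qs ul = Q_v a qs ul" by (simp add: Q_h_def Q_v_def)
  then show "RS_h a qs ul ur = RS_v a qs ul ur" by (simp add: RS_h_def RS_v_def RS_c_def fun_eq_iff)
next
  fix ul ur assume O: "ul \<in> Omega" "ur \<in> Omega" and "(ul, ur) \<in> CHl_compl a qs \<times> Omega"
  then have u: "ul \<in> CHl_compl a qs" by simp
  note v = CHl_compl_supersonic[OF assms u] and Q = Q_h_CHl_compl[OF assms u]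
  show "\<forall>\<xi>. RS_h a qs ul ur \<xi> =
      (if \<xi> < 0 then ul else RS_p a (u_check a (snd ul) ur) ur \<xi>)"
    using RS_p_supersonic[OF assms(1) O(1) v] Q(1) by (simp add: RS_h_def RS_c_def)
  have zero: "snd (RS_h a qs ul ur 0) = snd ul"
    using snd_RS_c_zero[of a ur "\<lambda>ul ur. Q_h a qs ul" ul] assms O Q by (simp add: RS_h_def)
  then show "snd (RS_h a qs ul ur 0) \<in> {0<..<qs}" using Q by simp
  show "\<forall>RS. c_Riemann_solver a RS \<longrightarrow> snd (RS ul ur 0) \<le> snd (RS_h a qs ul ur 0)"
  proof (intro allI impI)
    fix RS assume "c_Riemann_solver a RS"
    then obtain Q' where "Q' ul ur \<in> {0..Q_max a ul}" "RS ul ur = RS_c a Q' ul ur"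
      using O unfolding c_Riemann_solver_def D_def by blast
    \<comment> \<open>Since \<open>ul\<close> is supersonic, the upper bound
      \<open>Q_max a ul\<close> on any admissible flow is exactly \<open>snd ul\<close>, which
      \<open>RS_h\<close> attains.\<close>
    then show "snd (RS ul ur 0) \<le> snd (RS_h a qs ul ur 0)"
      using zero v snd_RS_c_zero[of a ur Q' ul] assms O by (simp add: Q_max_supersonic)
  qed
next
  fix p assume "p \<in> D"
  then show "case p of (ul, ur) \<Rightarrow> coherent_at (RS_h a qs) ul ur"
    using RS_h_coherent[OF assms] by (auto simp: D_def)
qed

end
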